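(* Let $\lambda,\lambda',\mu,\mu'\in\mathbb{C}^*$ and $\alpha,\alpha'\in\mathbb{C}$. Then the $\mathfrak{L}$-modules $\Omega(\lambda,\mu,\alpha)$ and $\Omega(\lambda',\mu',\alpha')$ are isomorphic if and only if $(\lambda,\mu,\alpha)=(\lambda',\mu',\alpha')$.
   Context: All vector spaces and Lie algebras are over $\mathbb{C}$; $\mathbb{C}^*$ denotes the nonzero complex numbers. The Virasoro algebra $\mathfrak{V}$ has basis $\{L_i, C\mid i\in\mathbb{Z}\}$ and relations $[L_i,L_j]=(j-i)L_{i+j}+\delta_{i+j,0}\frac{i^3-i}{12}C$, $[L_i,C]=0$. The loop-Virasoro algebra is $\mathfrak{L}=\mathfrak{V}\otimes\mathbb{C}[t^{\pm1}]$, with basis $\{L_{i,j}:=L_i\otimes t^j,\ C_j:=C\otimes t^j\mid (i,j)\in\mathbb{Z}^2\}$ and relations, for all $i,j,k,l\in\mathbb{Z}$, $$[L_{i,j},L_{k,l}]=(k-i)L_{i+k,j+l}+\delta_{i+k,0}\frac{i^3-i}{12}C_{j+l},\qquad [L_{i,j},C_l]=0,\qquad [C_j,C_l]=0.$$ For $\lambda,\mu\in\mathbb{C}^*$ and $\alpha\in\mathbb{C}$, $\Omega(\lambda,\mu,\alpha)$ is the $\mathfrak{L}$-module with underlying space $\mathbb{C}[t]$ and action $$L_{i,j}\cdot f(t)=\lambda^{i-j}\mu^j(t-i\alpha)f(t-i),\qquad C_i\cdot f(t)=0,$$ for $f(t)\in\mathbb{C}[t]$, $(i,j)\in\mathbb{Z}^2$.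 *)

theory Defs
  imports Complex_Main "HOL-Library.Poly_Mapping" "HOL-Computational_Algebra.Polynomial"
begin

section \<open>Lie algebras and their modules\<close>

locale lie_algebra = vector_space scale
  for scale :: "'k::field \<Rightarrow> 'a::ab_group_add \<Rightarrow> 'a" +
  fixes bracket :: "'a \<Rightarrow> 'a \<Rightarrow> 'a"
  assumes bracket_linear_left: "Vector_Spaces.linear scale scale (\<lambda>x. bracket x y)"
    and bracket_linear_right: "Vector_Spaces.linear scale scale (\<lambda>y. bracket x y)"
    and bracket_self: "bracket x x = 0"
    and jacobi: "bracket x (bracket y z) + bracket y (bracket z x) + bracket z (bracket x y) = 0"

locale lie_module = lie_algebra scale bracket
  for scale :: "'k::field \<Rightarrow> 'a::ab_group_add \<Rightarrow> 'a" and bracket :: "'a \<Rightarrow> 'a \<Rightarrow> 'a" +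
  fixes scaleV :: "'k \<Rightarrow> 'v::ab_group_add \<Rightarrow> 'v" and act :: "'a \<Rightarrow> 'v \<Rightarrow> 'v"
  assumes act_linear_left: "Vector_Spaces.linear scale scaleV (\<lambda>x. act x v)"
    and act_linear_right: "Vector_Spaces.linear scaleV scaleV (\<lambda>v. act x v)"
    and act_bracket: "act (bracket x y) v = act x (act y v) - act y (act x v)"

locale lie_module_iso =
  V: lie_module scale bracket scaleV actV + W: lie_module scale bracket scaleW actW
  for scale :: "'k::field \<Rightarrow> 'a::ab_group_add \<Rightarrow> 'a" and bracket :: "'a \<Rightarrow> 'a \<Rightarrow> 'a"
    and scaleV :: "'k \<Rightarrow> 'v::ab_group_add \<Rightarrow> 'v" and actV :: "'a \<Rightarrow> 'v \<Rightarrow> 'v"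
    and scaleW :: "'k \<Rightarrow> 'w::ab_group_add \<Rightarrow> 'w" and actW :: "'a \<Rightarrow> 'w \<Rightarrow> 'w" +
  fixes \<phi> :: "'v \<Rightarrow> 'w"
  assumes linear_iso: "Vector_Spaces.linear scaleV scaleW \<phi>"
    and bij_iso: "bij \<phi>"
    and intertwines: "\<phi> (actV x v) = actW x (\<phi> v)"

definition lie_modules_isomorphic ::
  "('k::field \<Rightarrow> 'a::ab_group_add \<Rightarrow> 'a) \<Rightarrow> ('a \<Rightarrow> 'a \<Rightarrow> 'a) \<Rightarrow>
   ('k \<Rightarrow> 'v::ab_group_add \<Rightarrow> 'v) \<Rightarrow> ('a \<Rightarrow> 'v \<Rightarrow> 'v) \<Rightarrow>
   ('k \<Rightarrow> 'w::ab_group_add \<Rightarrow> 'w) \<Rightarrow> ('a \<Rightarrow> 'w \<Rightarrow> 'w) \<Rightarrow> bool" where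
  "lie_modules_isomorphic scale bracket scaleV actV scaleW actW \<longleftrightarrow>
     (\<exists>\<phi>. lie_module_iso scale bracket scaleV actV scaleW actW \<phi>)"


section \<open>Linear extension from a basis\<close>

text \<open>
  The type \<^typ>\<open>'b \<Rightarrow>\<^sub>0 complex\<close> of finitely supported functions is the complex vector
  space with basis \<^term>\<open>Poly_Mapping.single b 1\<close> for \<open>b\<close> in \<^typ>\<open>'b\<close>.
\<close>

definition pm_scale :: "complex \<Rightarrow> ('b \<Rightarrow>\<^sub>0 complex) \<Rightarrow> ('b \<Rightarrow>\<^sub>0 complex)" where
  "pm_scale c x = Poly_Mapping.map ((*) c) x"

definition lin_ext :: "(complex \<Rightarrow> 'v \<Rightarrow> 'v) \<Rightarrow> ('b \<Rightarrow> 'v::ab_group_add) \<Rightarrow> ('b \<Rightarrow>\<^sub>0 complex) \<Rightarrow> 'v" where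
  "lin_ext scaleV g x = (\<Sum>b\<in>Poly_Mapping.keys x. scaleV (Poly_Mapping.lookup x b) (g b))"

lemma lookup_pm_scale [simp]: "Poly_Mapping.lookup (pm_scale c x) b = c * Poly_Mapping.lookup x b"
  by (auto simp: pm_scale_def map.rep_eq when_def)

lemma vector_space_pm_scale: "vector_space pm_scale"
  by unfold_locales (auto intro!: poly_mapping_eqI simp: lookup_add algebra_simps)

lemma vector_space_smult: "vector_space (smult :: complex \<Rightarrow> complex poly \<Rightarrow> complex poly)"
  by unfold_locales (auto simp: smult_add_right smult_add_left)

lemma pm_induct:
  assumes "P 0" "\<And>b c. P (pm_scale c (Poly_Mapping.single b 1))" "\<And>x y. P x \<Longrightarrow> P y \<Longrightarrow> P (x + y)"
  shows "P (x :: 'b \<Rightarrow>\<^sub>0 complex)"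
proof (induction x rule: update_induct)
  case const
  then show ?case by (fact assms(1))
next
  case (update f a b)
  have "Poly_Mapping.update a b f = f + pm_scale b (Poly_Mapping.single a 1)"
    using update(1) by (intro poly_mapping_eqI)
      (auto simp: lookup_update lookup_add lookup_single when_def in_keys_iff)
  then show ?case using assms update by simp
qed

lemma linear_lin_ext:
  fixes scaleV :: "complex \<Rightarrow> 'v::ab_group_add \<Rightarrow> 'v" and g :: "'b \<Rightarrow> 'v"
  assumes "vector_space scaleV"
  shows "Vector_Spaces.linear pm_scale scaleV (lin_ext scaleV g)"
proof -
  interpret V: vector_space scaleV by fact
  interpret P: vector_space "pm_scale :: complex \<Rightarrow> ('b \<Rightarrow>\<^sub>0 complex) \<Rightarrow> _"
    by (rule vector_space_pm_scale)
  have alt: "lin_ext scaleV g x = (\<Sum>b\<in>S. scaleV (Poly_Mapping.lookup x b) (g b))"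
    if "finite S" "Poly_Mapping.keys x \<subseteq> S" for S x
    unfolding lin_ext_def using that by (intro sum.mono_neutral_left) (auto simp: in_keys_iff)
  show ?thesis
  proof unfold_locales
    fix x y :: "'b \<Rightarrow>\<^sub>0 complex" and c
    let ?S = "Poly_Mapping.keys x \<union> Poly_Mapping.keys y"
    have "Poly_Mapping.keys (x + y) \<subseteq> ?S" by (rule Poly_Mapping.keys_add)
    then show "lin_ext scaleV g (x + y) = lin_ext scaleV g x + lin_ext scaleV g y"
      by (simp add: alt[of ?S] lookup_add V.scale_left_distrib sum.distrib)
    have "Poly_Mapping.keys (pm_scale c x) \<subseteq> Poly_Mapping.keys x"
      by (auto simp: in_keys_iff)
    then show "lin_ext scaleV g (pm_scale c x) = scaleV c (lin_ext scaleV g x)"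
      by (simp add: alt[of "Poly_Mapping.keys x"] V.scale_sum_right)
  qed
qed

lemma linear_lin_ext_fun:
  fixes scaleV :: "complex \<Rightarrow> 'v::ab_group_add \<Rightarrow> 'v"
  assumes V: "vector_space scaleV" and g: "\<And>b. Vector_Spaces.linear scaleU scaleV (\<lambda>u. g u b)"
  shows "Vector_Spaces.linear scaleU scaleV (\<lambda>u. lin_ext scaleV (g u) x)"
proof -
  interpret V: vector_space scaleV by fact
  interpret g: Vector_Spaces.linear scaleU scaleV "\<lambda>u. g u b" for b by (rule g)
  interpret U: vector_space scaleU by (rule g.vs1.vector_space_axioms)
  show ?thesis
    by unfold_locales
      (simp_all add: lin_ext_def g.add g.scale V.scale_right_distrib sum.distrib
        V.scale_sum_right mult.commute)
qed

lemma lin_ext_single: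
  assumes "vector_space scaleV"
  shows "lin_ext scaleV g (Poly_Mapping.single b c) = scaleV c (g b)"
proof -
  interpret vector_space scaleV by fact
  show ?thesis by (auto simp: lin_ext_def)
qed


section \<open>The loop-Virasoro algebra\<close>

datatype loop_vir_basis = L_idx int int | C_idx int

type_synonym loop_vir = "loop_vir_basis \<Rightarrow>\<^sub>0 complex"

definition L_gen :: "int \<Rightarrow> int \<Rightarrow> loop_vir" where
  "L_gen i j = Poly_Mapping.single (L_idx i j) 1"

definition C_gen :: "int \<Rightarrow> loop_vir" where
  "C_gen j = Poly_Mapping.single (C_idx j) 1"

fun loop_vir_bracket_basis :: "loop_vir_basis \<Rightarrow> loop_vir_basis \<Rightarrow> loop_vir" where
  "loop_vir_bracket_basis (L_idx i j) (L_idx k l) =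
     pm_scale (of_int (k - i)) (L_gen (i + k) (j + l))
     + pm_scale (if i + k = 0 then of_int (i ^ 3 - i) / 12 else 0) (C_gen (j + l))"
| "loop_vir_bracket_basis (L_idx i j) (C_idx l) = 0"
| "loop_vir_bracket_basis (C_idx j) (L_idx k l) = 0"
| "loop_vir_bracket_basis (C_idx j) (C_idx l) = 0"

definition loop_vir_bracket :: "loop_vir \<Rightarrow> loop_vir \<Rightarrow> loop_vir" where
  "loop_vir_bracket x y =
     lin_ext pm_scale (\<lambda>a. lin_ext pm_scale (\<lambda>b. loop_vir_bracket_basis a b) y) x"

lemma pm_scale_simps [simp]:
  "pm_scale c 0 = 0" "pm_scale 0 x = 0" "pm_scale 1 x = x"
  by (auto intro!: poly_mapping_eqI)

lemma pm_scale_add_right: "pm_scale c (x + y) = pm_scale c x + pm_scale c y"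
  by (rule poly_mapping_eqI) (simp add: lookup_add algebra_simps)

lemma pm_scale_minus_right: "pm_scale c (- x) = - pm_scale c x"
  by (rule poly_mapping_eqI) simp

lemma linear_rules:
  assumes "Vector_Spaces.linear s1 s2 f"
  shows "f (x + y) = f x + f y" "f (s1 c x) = s2 c (f x)" "f 0 = 0"
proof -
  interpret Vector_Spaces.linear s1 s2 f by fact
  show "f (x + y) = f x + f y" "f (s1 c x) = s2 c (f x)" "f 0 = 0"
    by (rule add scale zero)+
qed

lemma bracket_left: "Vector_Spaces.linear pm_scale pm_scale (\<lambda>x. loop_vir_bracket x y)"
  unfolding loop_vir_bracket_def by (rule linear_lin_ext[OF vector_space_pm_scale])

lemma bracket_right: "Vector_Spaces.linear pm_scale pm_scale (\<lambda>y. loop_vir_bracket x y)"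
  unfolding loop_vir_bracket_def
  by (intro linear_lin_ext_fun linear_lin_ext vector_space_pm_scale)

lemmas bracket_simps = linear_rules[OF bracket_left] linear_rules[OF bracket_right]

lemma bracket_basis:
  "loop_vir_bracket (Poly_Mapping.single a 1) (Poly_Mapping.single b 1) = loop_vir_bracket_basis a b"
  by (simp add: loop_vir_bracket_def lin_ext_single vector_space_pm_scale)

lemma loop_vir_relations:
  "loop_vir_bracket (L_gen i j) (L_gen k l) =
     pm_scale (of_int (k - i)) (L_gen (i + k) (j + l))
     + pm_scale (if i + k = 0 then of_int (i ^ 3 - i) / 12 else 0) (C_gen (j + l))"
  "loop_vir_bracket (L_gen i j) (C_gen l) = 0"
  "loop_vir_bracket (C_gen l) (L_gen i j) = 0"
  "loop_vir_bracket (C_gen j) (C_gen l) = 0"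
  by (simp_all only: L_gen_def[of i j] L_gen_def[of k l] C_gen_def[of j] C_gen_def[of l]
      bracket_basis loop_vir_bracket_basis.simps)

lemma loop_vir_induct:
  assumes "P 0" "\<And>c i j. P (pm_scale c (L_gen i j))" "\<And>c j. P (pm_scale c (C_gen j))"
    "\<And>x y. P x \<Longrightarrow> P y \<Longrightarrow> P (x + y)"
  shows "P (x :: loop_vir)"
proof (induction x rule: pm_induct)
  case (2 b c)
  then show ?case using assms(2,3) by (cases b) (simp_all add: L_gen_def C_gen_def)
qed (use assms in auto)

lemma bracket_skew: "loop_vir_bracket x y = - loop_vir_bracket y x"
proof (induction x rule: loop_vir_induct)
  case (2 c i j)
  show ?case
  proof (induction y rule: loop_vir_induct)
    case (2 d k l)
    have "loop_vir_bracket (L_gen i j) (L_gen k l) = - loop_vir_bracket (L_gen k l) (L_gen i j)"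
    proof (cases "i + k = 0")
      case True
      then have k: "k = - i" by simp
      show ?thesis
        unfolding k by (rule poly_mapping_eqI)
          (simp add: loop_vir_relations lookup_add lookup_minus lookup_uminus add.commute[of l j] field_simps)
    next
      case False
      then show ?thesis
        by (intro poly_mapping_eqI)
          (simp add: loop_vir_relations lookup_add add.commute[of k i] add.commute[of l j]
            algebra_simps)
    qed
    then show ?case by (intro poly_mapping_eqI) (simp add: bracket_simps mult.commute)
  qed (simp_all add: bracket_simps loop_vir_relations pm_scale_add_right)
next
  case (3 c j)
  show ?case
    by (induction y rule: loop_vir_induct) (simp_all add: bracket_simps loop_vir_relations pm_scale_add_right)
qed (simp_all add: bracket_simps)

lemma jacobi_LLL:
  "loop_vir_bracket (L_gen i j) (loop_vir_bracket (L_gen k l) (L_gen m n))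
   + loop_vir_bracket (L_gen k l) (loop_vir_bracket (L_gen m n) (L_gen i j))
   + loop_vir_bracket (L_gen m n) (loop_vir_bracket (L_gen i j) (L_gen k l)) = 0"
proof (rule poly_mapping_eqI)
  fix b
  have *: "m = - i - k" if "i + (k + m) = 0" using that by simp
  show "Poly_Mapping.lookup
     (loop_vir_bracket (L_gen i j) (loop_vir_bracket (L_gen k l) (L_gen m n))
   + loop_vir_bracket (L_gen k l) (loop_vir_bracket (L_gen m n) (L_gen i j))
   + loop_vir_bracket (L_gen m n) (loop_vir_bracket (L_gen i j) (L_gen k l))) b
   = Poly_Mapping.lookup 0 b"
  proof (cases "i + (k + m) = 0")
    case True
    then have m: "m = - i - k" by simp
    show ?thesis
      unfolding m
      by (simp add: loop_vir_relations bracket_simps lookup_add)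
        (simp add: L_gen_def C_gen_def lookup_single when_def algebra_simps
          add_divide_distrib diff_divide_distrib power3_eq_cube)
  next
    case False
    then show ?thesis
      by (simp add: loop_vir_relations bracket_simps lookup_add ac_simps)
        (simp add: algebra_simps)
  qed
qed

lemma lie_algebra_loop_vir: "lie_algebra pm_scale loop_vir_bracket"
proof (intro lie_algebra.intro lie_algebra_axioms.intro vector_space_pm_scale
    bracket_left bracket_right)
  fix x y z :: loop_vir
  have "Poly_Mapping.lookup (loop_vir_bracket x x) b = 0" for b
    using arg_cong[OF bracket_skew[of x x], of "\<lambda>p. Poly_Mapping.lookup p b"] by simp
  then show "loop_vir_bracket x x = 0" by (intro poly_mapping_eqI) simp
  let ?J = "\<lambda>x y z. loop_vir_bracket x (loop_vir_bracket y z)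
     + loop_vir_bracket y (loop_vir_bracket z x) + loop_vir_bracket z (loop_vir_bracket x y)"
  have add: "?J (x + x') y z = ?J x y z + ?J x' y z" "?J x (y + y') z = ?J x y z + ?J x y' z"
     "?J x y (z + z') = ?J x y z + ?J x y z'" for x x' y y' z z'
    by (simp_all add: bracket_simps)
  have scale: "?J (pm_scale c x) y z = pm_scale c (?J x y z)"
     "?J x (pm_scale c y) z = pm_scale c (?J x y z)"
     "?J x y (pm_scale c z) = pm_scale c (?J x y z)" for c x y z
    by (simp_all add: bracket_simps pm_scale_add_right)
  have C: "loop_vir_bracket (C_gen l) w = 0" "loop_vir_bracket w (C_gen l) = 0" for l w
    by (induction w rule: loop_vir_induct) (simp_all add: bracket_simps loop_vir_relations)
  have JLL: "?J (L_gen i j) (L_gen k l) z = 0" for i j k l z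
  proof (induction z rule: loop_vir_induct)
    case (2 c m n)
    show ?case unfolding scale jacobi_LLL by simp
  next
    case (4 x y)
    then show ?case unfolding add by simp
  qed (simp_all add: bracket_simps C)
  have JL: "?J (L_gen i j) y z = 0" for i j y z
  proof (induction y rule: loop_vir_induct)
    case (2 c m n)
    show ?case unfolding scale JLL by simp
  next
    case (4 x y)
    then show ?case unfolding add by simp
  qed (simp_all add: bracket_simps C)
  show "?J x y z = 0"
  proof (induction x rule: loop_vir_induct)
    case (2 c m n)
    show ?case unfolding scale JL by simp
  next
    case (4 x y)
    then show ?case unfolding add by simp
  qed (simp_all add: bracket_simps C)
qed


section \<open>The modules \<open>\<Omega>\<close>\<close>

text \<open>\<^term>\<open>pcompose f [:- of_int i, 1:]\<close> is the shifted polynomial \<open>f(t - i)\<close>.\<close>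

fun Omega_act_basis ::
  "complex \<Rightarrow> complex \<Rightarrow> complex \<Rightarrow> loop_vir_basis \<Rightarrow> complex poly \<Rightarrow> complex poly" where
  "Omega_act_basis lam mu \<alpha> (L_idx i j) f =
     smult (lam powi (i - j) * mu powi j)
       ([:- (of_int i * \<alpha>), 1:] * pcompose f [:- of_int i, 1:])"
| "Omega_act_basis lam mu \<alpha> (C_idx i) f = 0"

definition Omega_act ::
  "complex \<Rightarrow> complex \<Rightarrow> complex \<Rightarrow> loop_vir \<Rightarrow> complex poly \<Rightarrow> complex poly" where
  "Omega_act lam mu \<alpha> x f = lin_ext smult (\<lambda>b. Omega_act_basis lam mu \<alpha> b f) x"

lemma Omega_left: "Vector_Spaces.linear pm_scale smult (\<lambda>x. Omega_act lam mu \<alpha> x f)"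
  unfolding Omega_act_def by (rule linear_lin_ext[OF vector_space_smult])

lemma Omega_right: "Vector_Spaces.linear smult smult (\<lambda>f. Omega_act lam mu \<alpha> x f)"
proof -
  interpret vector_space "smult :: complex \<Rightarrow> complex poly \<Rightarrow> complex poly"
    by (rule vector_space_smult)
  have "Vector_Spaces.linear smult smult (\<lambda>f. Omega_act_basis lam mu \<alpha> b f)" for b
    by (cases b; unfold_locales)
      (simp_all add: pcompose_add pcompose_smult smult_add_right distrib_left mult.commute
        del: mult_pCons_left mult_pCons_right)
  then show ?thesis
    unfolding Omega_act_def by (intro linear_lin_ext_fun vector_space_smult)
qed

lemmas Omega_simps = linear_rules[OF Omega_left] linear_rules[OF Omega_right]

lemma Omega_act_L:
  "Omega_act lam mu \<alpha> (L_gen i j) f =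
     smult (lam powi (i - j) * mu powi j)
       ([:- (of_int i * \<alpha>), 1:] * pcompose f [:- of_int i, 1:])"
  by (simp add: Omega_act_def L_gen_def lin_ext_single vector_space_smult)

lemma Omega_act_C: "Omega_act lam mu \<alpha> (C_gen i) f = 0"
  by (simp add: Omega_act_def C_gen_def lin_ext_single vector_space_smult)

lemma Omega_bracket_LL:
  assumes "lam \<noteq> 0" "mu \<noteq> 0"
  shows "Omega_act lam mu \<alpha> (loop_vir_bracket (L_gen i j) (L_gen k l)) f =
    Omega_act lam mu \<alpha> (L_gen i j) (Omega_act lam mu \<alpha> (L_gen k l) f)
    - Omega_act lam mu \<alpha> (L_gen k l) (Omega_act lam mu \<alpha> (L_gen i j) f)"
proof -
  have e: "lam powi (i + k - (j + l)) = lam powi (i - j) * lam powi (k - l)"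
    using assms(1) by (subst power_int_add[symmetric]) (auto intro: arg_cong simp: algebra_simps)
  have e': "mu powi (j + l) = mu powi j * mu powi l"
    using assms(2) by (simp add: power_int_add)
  show ?thesis
    by (rule poly_eq_poly_eq_iff[THEN iffD1], rule ext)
      (simp add: loop_vir_relations Omega_simps Omega_act_L Omega_act_C e e' poly_pcompose
        algebra_simps)
qed

lemma lie_module_Omega:
  assumes "lam \<noteq> 0" "mu \<noteq> 0"
  shows "lie_module pm_scale loop_vir_bracket smult (Omega_act lam mu \<alpha>)"
proof (intro lie_module.intro lie_module_axioms.intro lie_algebra_loop_vir Omega_left Omega_right)
  fix x y :: loop_vir and f :: "complex poly"
  have C: "loop_vir_bracket (C_gen l) w = 0" "loop_vir_bracket w (C_gen l) = 0" for l w
    by (induction w rule: loop_vir_induct) (simp_all add: bracket_simps loop_vir_relations)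
  have L: "Omega_act lam mu \<alpha> (loop_vir_bracket (L_gen i j) y) f =
      Omega_act lam mu \<alpha> (L_gen i j) (Omega_act lam mu \<alpha> y f)
      - Omega_act lam mu \<alpha> y (Omega_act lam mu \<alpha> (L_gen i j) f)" for i j
    by (induction y rule: loop_vir_induct)
      (simp_all add: bracket_simps C Omega_simps Omega_act_C Omega_bracket_LL[OF assms]
        smult_diff_right)
  show "Omega_act lam mu \<alpha> (loop_vir_bracket x y) f =
      Omega_act lam mu \<alpha> x (Omega_act lam mu \<alpha> y f)
      - Omega_act lam mu \<alpha> y (Omega_act lam mu \<alpha> x f)"
    by (induction x rule: loop_vir_induct)
      (simp_all add: bracket_simps C Omega_simps Omega_act_C L smult_diff_right)
qed

end

(* L_{0,0} acts on every Omega(lam, mu, alpha) as multiplication by t.  An isomorphism phi is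
   therefore C[t]-linear, so phi f = f * phi 1, and surjectivity makes phi 1 a nonzero constant.
   Cancelling it, the actions of L_{1,0} and L_{0,1} on 1 coincide in both modules, and these
   polynomials determine lam, alpha and mu. *)
theory Submission
  imports Defs
begin

lemma Omega_act_L00: "Omega_act lam mu \<alpha> (L_gen 0 0) f = [:0, 1:] * f"
  by (simp add: Omega_act_L pcompose_idR)

lemma Omega_act_L_1:
  "Omega_act lam mu \<alpha> (L_gen i j) 1 = smult (lam powi (i - j) * mu powi j) [:- (of_int i * \<alpha>), 1:]"
  by (simp add: Omega_act_L pcompose_1)

text \<open>Constants and \<open>[:0, 1:]\<close> generate the polynomial ring, so such a map is
  linear over that ring, hence determined by its value at 1. The induction follows the Horner form
  of \<open>p\<close>.\<close>

lemma poly_module_hom_eq_mult: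
  fixes \<phi> :: "'a::comm_ring_1 poly \<Rightarrow> 'a poly"
  assumes add: "\<And>p q. \<phi> (p + q) = \<phi> p + \<phi> q"
    and smult: "\<And>c p. \<phi> (smult c p) = smult c (\<phi> p)"
    and X: "\<And>p. \<phi> ([:0, 1:] * p) = [:0, 1:] * \<phi> p"
  shows "\<phi> p = p * \<phi> 1"
proof (induction p)
  case 0
  show ?case using smult[of 0 0] by simp
next
  case (pCons a p)
  have eq: "pCons a p = smult a 1 + [:0, 1:] * p"
    by simp
  have "\<phi> (pCons a p) = smult a (\<phi> 1) + [:0, 1:] * \<phi> p"
    unfolding eq add smult X ..
  with pCons.IH show ?case by simp
qed

lemma Omega_iso_imp_eq:
  assumes "lie_module_iso pm_scale loop_vir_bracket
             smult (Omega_act lam mu \<alpha>) smult (Omega_act lam' mu' \<alpha>') \<phi>"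
    and "lam \<noteq> 0"
  shows "lam = lam' \<and> mu = mu' \<and> \<alpha> = \<alpha>'"
proof -
  interpret lie_module_iso pm_scale loop_vir_bracket
    smult "Omega_act lam mu \<alpha>" smult "Omega_act lam' mu' \<alpha>'" \<phi> by fact
  note lin = linear_rules[OF linear_iso]
  have mult: "\<phi> p = p * \<phi> 1" for p
    using lin intertwines[of "L_gen 0 0"]
    by (intro poly_module_hom_eq_mult) (simp_all only: Omega_act_L00)
  obtain q where "\<phi> q = 1"
    using bij_iso by (metis bij_pointE)
  \<comment> \<open>By \<open>mult\<close>, \<open>1 = q * \<phi> 1\<close>, and the units among
    complex polynomials are the nonzero constants.\<close>
  then have "\<phi> 1 dvd 1"
    by (metis mult dvd_triv_right)
  then obtain c where c: "\<phi> 1 = [:c:]" "c \<noteq> 0"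
    by (auto simp: is_unit_poly_iff dvd_field_iff)
  \<comment> \<open>Now \<phi> is scaling by \<open>c\<close>, so intertwining on the vector 1 gives
    this up to the factor \<open>c\<close>.\<close>
  have eq: "Omega_act lam mu \<alpha> x 1 = Omega_act lam' mu' \<alpha>' x 1" for x
  proof -
    have "smult c (Omega_act lam mu \<alpha> x 1) = \<phi> (Omega_act lam mu \<alpha> x 1)"
      by (subst mult) (simp add: c)
    also have "\<dots> = Omega_act lam' mu' \<alpha>' x (smult c 1)"
      by (simp add: intertwines c)
    also have "\<dots> = smult c (Omega_act lam' mu' \<alpha>' x 1)"
      by (rule Omega_simps)
    finally show ?thesis
      using c(2) by (metis smult_cancel)
  qed
  \<comment> \<open>\<open>L_gen 1 0\<close> sends 1 to lam (t - \<alpha>): the leading coefficient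
    gives lam, then the constant term gives \<alpha> as lam is nonzero. \<open>L_gen 0 1\<close>
    sends 1 to (mu / lam) t, which gives mu.\<close>
  show ?thesis
    using eq[of "L_gen 1 0"] eq[of "L_gen 0 1"] assms(2) by (auto simp: Omega_act_L_1)
qed

theorem proposition2p3:
  fixes lam lam' mu mu' \<alpha> \<alpha>' :: complex
  assumes "lam \<noteq> 0" and "lam' \<noteq> 0" and "mu \<noteq> 0" and "mu' \<noteq> 0"
  shows "lie_modules_isomorphic pm_scale loop_vir_bracket
           smult (Omega_act lam mu \<alpha>) smult (Omega_act lam' mu' \<alpha>')
         \<longleftrightarrow> (lam, mu, \<alpha>) = (lam', mu', \<alpha>')"
proof
  assume "lie_modules_isomorphic pm_scale loop_vir_bracket
            smult (Omega_act lam mu \<alpha>) smult (Omega_act lam' mu' \<alpha>')"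
  then show "(lam, mu, \<alpha>) = (lam', mu', \<alpha>')"
    using Omega_iso_imp_eq assms(1) by (auto simp: lie_modules_isomorphic_def)
next
  assume eq: "(lam, mu, \<alpha>) = (lam', mu', \<alpha>')"
  \<comment> \<open>Provides \<open>linear_id\<close> for \<open>smult\<close>, so that the identity
    can serve as the isomorphism.\<close>
  interpret vector_space "smult :: complex \<Rightarrow> complex poly \<Rightarrow> complex poly"
    by (rule vector_space_smult)
  have "lie_module_iso pm_scale loop_vir_bracket
          smult (Omega_act lam mu \<alpha>) smult (Omega_act lam mu \<alpha>) id"
    using assms
    by (intro lie_module_iso.intro lie_module_iso_axioms.intro lie_module_Omega linear_id) auto
  with eq show "lie_modules_isomorphic pm_scale loop_vir_bracket
      smult (Omega_act lam mu \<alpha>) smult (Omega_act lam' mu' \<alpha>')"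
    by (auto simp: lie_modules_isomorphic_def)
qed

end
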